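(* The natural partial order on the semigroup $\mathscr{PO}_\infty(\mathbb{N}^2_\leqslant)$ coincides with the partial order induced on $\mathscr{PO}_\infty(\mathbb{N}^2_\leqslant)$ by the natural partial order of the symmetric inverse monoid $\mathscr{I}_{\mathbb{N}\times\mathbb{N}}$ over the set $\mathbb{N}\times\mathbb{N}$.
   Context: $\mathbb{N}$ is the set of positive integers with its usual order, and $\mathbb{N}^2_\leqslant$ is $\mathbb{N}\times\mathbb{N}$ with the product order: $(i,m)\leqslant(j,n)$ iff $i\le j$ and $m\le n$. Partial maps are written on the right and composed left to right: $x(\alpha\beta)=(x\alpha)\beta$, with $\operatorname{dom}(\alpha\beta)=\{y\in\operatorname{dom}\alpha : y\alpha\in\operatorname{dom}\beta\}$. A partial map $\alpha\colon X\rightharpoonup X$ of a poset is monotone if $x\leqslant y$ implies $(x)\alpha\leqslant(y)\alpha$ for all $x,y\in\operatorname{dom}\alpha$. $\mathscr{PO}_\infty(\mathbb{N}^2_\leqslant)$ is the monoid, under composition, of all injective monotone partial selfmaps $\alpha$ of $\mathbb{N}^2_\leqslant$ such that $\operatorname{dom}\alpha$ and $\operatorname{ran}\alpha$ have finite complement in $\mathbb{N}\times\mathbb{N}$. The symmetric inverse monoid $\mathscr{I}_{\mathbb{N}\times\mathbb{N}}$ is the monoid of all injective partial selfmaps of $\mathbb{N}\times\mathbb{N}$ under the same composition; $\mathscr{PO}_\infty(\mathbb{N}^2_\leqslant)$ is a submonoid of it. The natural partial order (in the sense of Mitsch) on an arbitrary semigroup $S$ is the relation: $a$ is below $b$ iff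 there are $x,y\in S^1$ with $a=xb=by$ and $xa=ay=a$. Here $S^1$ is $S$ with an identity adjoined if $S$ has none. On an inverse semigroup this is the usual order: $a$ is below $b$ iff $a=be$ for some idempotent $e$. *)

theory Defs
  imports "HOL-Algebra.Group" "HOL-Library.Product_Order"
begin

text \<open>A semigroup is the carrier and multiplication of a \<^typ>\<open>'a monoid\<close> record; the
  \<open>one\<close> field is ignored up to and including \<open>natural_order\<close>. Elements of
  \<open>S\<^sup>1\<close> are options, with \<^term>\<open>None\<close> as the adjoined identity.\<close>

definition has_identity :: "('a, 'b) monoid_scheme \<Rightarrow> bool" where
  "has_identity S \<longleftrightarrow>
     (\<exists>e \<in> carrier S. \<forall>x \<in> carrier S. e \<otimes>\<^bsub>S\<^esub> x = x \<and> x \<otimes>\<^bsub>S\<^esub> e = x)"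

definition carrier1 :: "('a, 'b) monoid_scheme \<Rightarrow> 'a option set" where
  "carrier1 S = Some ` carrier S \<union> (if has_identity S then {} else {None})"

fun mult1 :: "('a, 'b) monoid_scheme \<Rightarrow> 'a option \<Rightarrow> 'a option \<Rightarrow> 'a option" where
  "mult1 S (Some x) (Some y) = Some (x \<otimes>\<^bsub>S\<^esub> y)"
| "mult1 S None y = y"
| "mult1 S x None = x"

text \<open>Mitsch's natural partial order: \<open>(a, b)\<close> belongs to it iff \<open>a\<close> is below \<open>b\<close>.\<close>

definition natural_order :: "('a, 'b) monoid_scheme \<Rightarrow> ('a \<times> 'a) set" where
  "natural_order S = {(a, b). a \<in> carrier S \<and> b \<in> carrier S \<and>
     (\<exists>x \<in> carrier1 S. \<exists>y \<in> carrier1 S.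
        Some a = mult1 S x (Some b) \<and> mult1 S x (Some b) = mult1 S (Some b) y \<and>
        mult1 S x (Some a) = mult1 S (Some a) y \<and> mult1 S (Some a) y = Some a)}"

text \<open>Maps are written on the right, so the product \<open>\<alpha>\<beta>\<close> applies \<open>\<alpha>\<close> first.\<close>

definition sym_inv_monoid :: "'a set \<Rightarrow> ('a \<rightharpoonup> 'a) monoid" where
  "sym_inv_monoid X =
     \<lparr>carrier = {\<alpha>. dom \<alpha> \<subseteq> X \<and> ran \<alpha> \<subseteq> X \<and> inj_on \<alpha> (dom \<alpha>)},
      mult = (\<lambda>\<alpha> \<beta>. \<beta> \<circ>\<^sub>m \<alpha>),
      one = Some |` X\<rparr>"

definition PN2 :: "(nat \<times> nat) set" where
  "PN2 = {1..} \<times> {1..}"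

text \<open>The order on \<^typ>\<open>nat \<times> nat\<close> is the product order of
  \<^theory>\<open>HOL-Library.Product_Order\<close>.\<close>

definition PO_inf :: "(nat \<times> nat \<rightharpoonup> nat \<times> nat) monoid" where
  "PO_inf = (sym_inv_monoid PN2)
     \<lparr>carrier := {\<alpha> \<in> carrier (sym_inv_monoid PN2).
        mono_on (dom \<alpha>) (\<lambda>x. the (\<alpha> x)) \<and>
        finite (PN2 - dom \<alpha>) \<and> finite (PN2 - ran \<alpha>)}\<rparr>"

lemma sym_inv_mem_iff:
  "\<alpha> \<in> carrier (sym_inv_monoid X) \<longleftrightarrow>
     (\<forall>p q. \<alpha> p = Some q \<longrightarrow> p \<in> X \<and> q \<in> X) \<and>
     (\<forall>p p' q. \<alpha> p = Some q \<longrightarrow> \<alpha> p' = Some q \<longrightarrow> p = p')"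
  unfolding sym_inv_monoid_def by (auto simp: dom_def ran_def inj_on_def)

lemma sym_inv_mult [simp]: "\<alpha> \<otimes>\<^bsub>sym_inv_monoid X\<^esub> \<beta> = \<beta> \<circ>\<^sub>m \<alpha>"
  by (simp add: sym_inv_monoid_def)

lemma sym_inv_one [simp]: "\<one>\<^bsub>sym_inv_monoid X\<^esub> = Some |` X"
  by (simp add: sym_inv_monoid_def)

lemma restrict_Some_mem: "Y \<subseteq> X \<Longrightarrow> Some |` Y \<in> carrier (sym_inv_monoid X)"
  by (auto simp: sym_inv_mem_iff restrict_map_def split: if_splits)

lemma monoid_sym_inv: "monoid (sym_inv_monoid X)"
proof (rule monoidI)
  fix x y assume "x \<in> carrier (sym_inv_monoid X)" "y \<in> carrier (sym_inv_monoid X)"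
  then show "x \<otimes>\<^bsub>sym_inv_monoid X\<^esub> y \<in> carrier (sym_inv_monoid X)"
    unfolding sym_inv_mem_iff sym_inv_mult map_comp_Some_iff by metis
next
  show "\<one>\<^bsub>sym_inv_monoid X\<^esub> \<in> carrier (sym_inv_monoid X)"
    by (simp add: restrict_Some_mem)
next
  fix x assume x: "x \<in> carrier (sym_inv_monoid X)"
  have "x p = None" if "p \<notin> X" for p
    using x that unfolding sym_inv_mem_iff by (metis not_None_eq)
  then show "\<one>\<^bsub>sym_inv_monoid X\<^esub> \<otimes>\<^bsub>sym_inv_monoid X\<^esub> x = x"
    by (simp add: fun_eq_iff map_comp_def restrict_map_def)
qed (auto simp: map_comp_def restrict_map_def fun_eq_iff sym_inv_mem_iff split: option.splits)

lemma submonoid_PO_inf: "submonoid (carrier PO_inf) (sym_inv_monoid PN2)"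
proof
  show "carrier PO_inf \<subseteq> carrier (sym_inv_monoid PN2)"
    by (auto simp: PO_inf_def)
next
  fix x y assume x: "x \<in> carrier PO_inf" and y: "y \<in> carrier PO_inf"
  have xs: "x \<in> carrier (sym_inv_monoid PN2)" and ys: "y \<in> carrier (sym_inv_monoid PN2)"
    using x y by (auto simp: PO_inf_def)
  have mem: "y \<circ>\<^sub>m x \<in> carrier (sym_inv_monoid PN2)"
    using monoid.m_closed [OF monoid_sym_inv xs ys] by simp
  have mono: "mono_on (dom (y \<circ>\<^sub>m x)) (\<lambda>p. the ((y \<circ>\<^sub>m x) p))"
  proof (rule mono_onI)
    fix r s assume "r \<in> dom (y \<circ>\<^sub>m x)" "s \<in> dom (y \<circ>\<^sub>m x)" and le: "r \<le> s"
    then obtain r' r'' s' s'' where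
      *: "x r = Some r'" "y r' = Some r''" "x s = Some s'" "y s' = Some s''"
      by (auto simp: map_comp_Some_iff)
    have "r' \<le> s'"
      using x le * mono_onD[of "dom x" "\<lambda>x'. the (x x')" r s] by (auto simp: PO_inf_def)
    then have "r'' \<le> s''"
      using y * mono_onD[of "dom y" "\<lambda>x'. the (y x')" r' s'] by (auto simp: PO_inf_def)
    then show "the ((y \<circ>\<^sub>m x) r) \<le> the ((y \<circ>\<^sub>m x) s)" using * by simp
  qed
  have fx: "finite (PN2 - dom x)" "finite (PN2 - ran x)"
    and fy: "finite (PN2 - dom y)" "finite (PN2 - ran y)"
    using x y by (auto simp: PO_inf_def)
  define h where "h q = (SOME p. x p = Some q)" for q
  have "PN2 - dom (y \<circ>\<^sub>m x) \<subseteq> (PN2 - dom x) \<union> h ` (PN2 - dom y)"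
  proof
    fix p assume p: "p \<in> PN2 - dom (y \<circ>\<^sub>m x)"
    show "p \<in> (PN2 - dom x) \<union> h ` (PN2 - dom y)"
    proof (cases "x p")
      case None
      then show ?thesis using p by auto
    next
      case (Some q)
      have "x (h q) = Some q" unfolding h_def using Some by (rule someI)
      then have "h q = p" using xs Some unfolding sym_inv_mem_iff by metis
      moreover have "q \<in> PN2" using xs Some unfolding sym_inv_mem_iff by metis
      moreover have "q \<notin> dom y" using p Some by (auto simp: map_comp_Some_iff)
      ultimately show ?thesis by blast
    qed
  qed
  then have f1: "finite (PN2 - dom (y \<circ>\<^sub>m x))"
    using fx fy by (meson finite_UnI finite_imageI finite_subset)
  have "PN2 - ran (y \<circ>\<^sub>m x) \<subseteq> (PN2 - ran y) \<union> (\<lambda>q. the (y q)) ` (PN2 - ran x)"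
  proof
    fix s assume s: "s \<in> PN2 - ran (y \<circ>\<^sub>m x)"
    show "s \<in> (PN2 - ran y) \<union> (\<lambda>q. the (y q)) ` (PN2 - ran x)"
    proof (cases "s \<in> ran y")
      case False
      then show ?thesis using s by auto
    next
      case True
      then obtain q where q: "y q = Some s" by (auto simp: ran_def)
      have "q \<in> PN2" using ys q unfolding sym_inv_mem_iff by metis
      moreover have "q \<notin> ran x"
      proof
        assume "q \<in> ran x"
        then obtain p where "x p = Some q" by (auto simp: ran_def)
        then have "(y \<circ>\<^sub>m x) p = Some s" using q by simp
        then show False using s by (blast intro: ranI)
      qed
      moreover have "s = the (y q)" using q by simp
      ultimately show ?thesis by blast
    qed
  qed
  then have f2: "finite (PN2 - ran (y \<circ>\<^sub>m x))"
    using fx fy by (meson finite_UnI finite_imageI finite_subset)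
  show "x \<otimes>\<^bsub>sym_inv_monoid PN2\<^esub> y \<in> carrier PO_inf"
    using mem mono f1 f2 by (simp add: PO_inf_def)
next
  have "ran (Some |` PN2) = PN2" "dom (Some |` PN2) = PN2"
    by (auto simp: ran_def restrict_map_def split: if_splits)
  then show "\<one>\<^bsub>sym_inv_monoid PN2\<^esub> \<in> carrier PO_inf"
    using restrict_Some_mem[of PN2 PN2]
    by (simp add: PO_inf_def mono_on_def)
qed

lemma natural_order_monoid:
  assumes "monoid S"
  shows "natural_order S = {(a, b). a \<in> carrier S \<and> b \<in> carrier S \<and>
     (\<exists>x \<in> carrier S. \<exists>y \<in> carrier S.
        a = x \<otimes>\<^bsub>S\<^esub> b \<and> a = b \<otimes>\<^bsub>S\<^esub> y \<and> x \<otimes>\<^bsub>S\<^esub> a = a \<and> a \<otimes>\<^bsub>S\<^esub> y = a)}"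
proof -
  interpret monoid S by fact
  have "has_identity S" unfolding has_identity_def using one_closed by force
  then show ?thesis unfolding natural_order_def carrier1_def by (auto; metis)
qed

text \<open>On the symmetric inverse monoid this is the usual order of an inverse semigroup.\<close>

lemma natural_order_sym_inv:
  "natural_order (sym_inv_monoid X) =
     {(a, b). a \<in> carrier (sym_inv_monoid X) \<and> b \<in> carrier (sym_inv_monoid X) \<and>
        (\<exists>e \<in> carrier (sym_inv_monoid X). e \<otimes>\<^bsub>sym_inv_monoid X\<^esub> e = e \<and>
           a = b \<otimes>\<^bsub>sym_inv_monoid X\<^esub> e)}"
    (is "_ = ?R")
proof (intro equalityI subrelI)
  fix a b assume "(a, b) \<in> natural_order (sym_inv_monoid X)"
  then obtain x y where a: "a \<in> carrier (sym_inv_monoid X)"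
    and b: "b \<in> carrier (sym_inv_monoid X)" and y: "y \<in> carrier (sym_inv_monoid X)"
    and a_by: "a = y \<circ>\<^sub>m b" and ay: "y \<circ>\<^sub>m a = a"
    unfolding natural_order_monoid[OF monoid_sym_inv] by auto
  let ?e = "Some |` ran a"
  have e: "?e \<in> carrier (sym_inv_monoid X)"
    using a by (intro restrict_Some_mem) (auto simp: ran_def sym_inv_mem_iff)
  have ee: "?e \<circ>\<^sub>m ?e = ?e"
    by (auto simp: fun_eq_iff map_comp_def restrict_map_def)
  have fix_y: "y q = Some q" if "a p = Some q" for p q
    using fun_cong[OF ay, of p] that by simp
  have iff: "a p = Some q \<longleftrightarrow> (?e \<circ>\<^sub>m b) p = Some q" for p q
  proof
    assume pq: "a p = Some q"
    obtain r where r: "b p = Some r" "y r = Some q"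
      using pq by (subst (asm) a_by) (auto simp: map_comp_Some_iff)
    have "r = q" using y r(2) fix_y[OF pq] unfolding sym_inv_mem_iff by metis
    then show "(?e \<circ>\<^sub>m b) p = Some q"
      using r pq by (auto simp: map_comp_Some_iff restrict_map_def ran_def)
  next
    assume "(?e \<circ>\<^sub>m b) p = Some q"
    then have bp: "b p = Some q" and "q \<in> ran a"
      by (auto simp: map_comp_Some_iff restrict_map_def split: if_splits)
    then have "y q = Some q" using fix_y by (auto simp: ran_def)
    then show "a p = Some q" using bp by (subst a_by) simp
  qed
  have "a = ?e \<circ>\<^sub>m b"
  proof
    fix p show "a p = (?e \<circ>\<^sub>m b) p" using iff[of p] by (metis not_Some_eq)
  qed
  then show "(a, b) \<in> ?R" using a b e ee by auto
next
  fix a b assume "(a, b) \<in> ?R"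
  then obtain e where a: "a \<in> carrier (sym_inv_monoid X)"
    and b: "b \<in> carrier (sym_inv_monoid X)" and e: "e \<in> carrier (sym_inv_monoid X)"
    and ee: "e \<circ>\<^sub>m e = e" and abe: "a = e \<circ>\<^sub>m b"
    by auto
  have e_id: "q = p" if pq: "e p = Some q" for p q
  proof -
    have "e q = Some q" using fun_cong[OF ee, of p] pq by simp
    then show ?thesis using e pq unfolding sym_inv_mem_iff by metis
  qed
  let ?x = "Some |` dom a"
  have x: "?x \<in> carrier (sym_inv_monoid X)"
    using a by (intro restrict_Some_mem) (auto simp: sym_inv_mem_iff)
  have ab: "b p = Some q \<and> e q = Some q" if "a p = Some q" for p q
    using that e_id unfolding abe map_comp_Some_iff by metis
  have 1: "a = b \<circ>\<^sub>m ?x"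
  proof
    fix p show "a p = (b \<circ>\<^sub>m ?x) p"
      by (cases "a p") (auto simp: map_comp_def restrict_map_def dest: ab)
  qed
  have 2: "a \<circ>\<^sub>m ?x = a"
  proof
    fix p show "(a \<circ>\<^sub>m ?x) p = a p"
      by (cases "a p") (auto simp: map_comp_def restrict_map_def)
  qed
  have 3: "e \<circ>\<^sub>m a = a"
  proof
    fix p show "(e \<circ>\<^sub>m a) p = a p"
      by (cases "a p") (auto simp: map_comp_def dest: ab)
  qed
  show "(a, b) \<in> natural_order (sym_inv_monoid X)"
    unfolding natural_order_monoid[OF monoid_sym_inv]
    using a b e x 1 2 3 abe by auto
qed

end

theory Submission
  imports Defs
begin

text \<open>
  In the symmetric inverse monoid the natural order is restriction of maps: if \<open>a\<close> is
  below \<open>b\<close>, then the left witness \<open>x\<close> with \<open>xa = a\<close> must fix \<open>dom a\<close> pointwise because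
  \<open>a\<close> is injective, so \<open>a = xb\<close> agrees with \<open>b\<close> there. Conversely, if \<open>a\<close> is a restriction of
  \<open>b\<close>, the partial identities on \<open>dom a\<close> and \<open>ran a\<close> are witnesses.

  Passing to a submonoid can only shrink the natural order, by having fewer witnesses. For
  \<open>PO_inf\<close> nothing is lost: for \<open>a\<close> in \<open>PO_inf\<close> the sets \<open>dom a\<close> and \<open>ran a\<close> are
  cofinite, and a partial identity on a cofinite set is monotone, so the canonical witnesses
  already lie in \<open>PO_inf\<close>.
\<close>

lemma natural_order_submonoid:
  assumes "monoid S" "submonoid H S"
  shows "natural_order (S\<lparr>carrier := H\<rparr>) \<subseteq> natural_order S \<inter> (H \<times> H)"
proof -
  have "H \<subseteq> carrier S"
    using assms(2) by (rule submonoid.subset)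
  moreover have "monoid (S\<lparr>carrier := H\<rparr>)"
    using assms(2,1) by (rule submonoid.submonoid_is_monoid)
  ultimately show ?thesis
    unfolding natural_order_monoid[OF assms(1)] by (auto simp: natural_order_monoid)
qed

lemma natural_order_sym_inv_map_le:
  assumes "(a, b) \<in> natural_order (sym_inv_monoid X)"
  shows "a \<subseteq>\<^sub>m b"
proof -
  obtain x where a: "a \<in> carrier (sym_inv_monoid X)"
    and a_xb: "a = b \<circ>\<^sub>m x" and xa: "a \<circ>\<^sub>m x = a"
    using assms unfolding natural_order_monoid[OF monoid_sym_inv] by auto
  have "b p = Some q" if pq: "a p = Some q" for p q
  proof -
    obtain r where r: "x p = Some r" "a r = Some q"
      using pq fun_cong[OF xa, of p] by (auto simp: map_comp_Some_iff)
    \<comment> \<open>Injectivity of \<open>a\<close> forces \<open>x\<close> to fix \<open>p\<close>.\<close>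
    have "r = p" using a pq r(2) unfolding sym_inv_mem_iff by metis
    then show ?thesis using pq r(1) fun_cong[OF a_xb, of p] by simp
  qed
  then show ?thesis by (auto simp: map_le_def)
qed

lemma map_comp_Some_dom: "a \<subseteq>\<^sub>m b \<Longrightarrow> b \<circ>\<^sub>m (Some |` dom a) = a"
  by (auto simp: fun_eq_iff map_comp_def restrict_map_def map_le_def domIff)

text \<open>Injectivity of the larger map is essential here: it prevents points outside
  \<open>dom a\<close> from being sent by \<open>b\<close> into \<open>ran a\<close>.\<close>

lemma map_comp_Some_ran:
  assumes "a \<subseteq>\<^sub>m b" "inj_on b (dom b)"
  shows "(Some |` ran a) \<circ>\<^sub>m b = a"
proof
  fix p
  show "((Some |` ran a) \<circ>\<^sub>m b) p = a p"
  proof (cases "b p")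
    case None
    then have "a p = None" using assms(1) by (metis domIff map_le_def)
    then show ?thesis using None by simp
  next
    case (Some q)
    have "a p = Some q" if q: "q \<in> ran a"
    proof -
      obtain r where r: "a r = Some q" using q by (auto simp: ran_def)
      then have "b r = Some q" using assms(1) by (metis domI map_le_def)
      then have "r = p" using assms(2) Some by (metis domI inj_onD)
      then show ?thesis using r by simp
    qed
    moreover have "a p = None" if "q \<notin> ran a"
      using that Some assms(1) by (metis domI map_le_def not_None_eq ranI)
    ultimately show ?thesis using Some by (simp add: restrict_map_def)
  qed
qed

lemma Some_restrict_in_PO_inf:
  assumes "Y \<subseteq> PN2" "finite (PN2 - Y)"
  shows "Some |` Y \<in> carrier PO_inf"
proof -
  have "ran (Some |` Y) = Y" "dom (Some |` Y) = Y"
    by (auto simp: ran_def restrict_map_def split: if_splits)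
  then show ?thesis
    using assms restrict_Some_mem[OF assms(1)] by (simp add: PO_inf_def mono_on_def)
qed

theorem mainTheorem5:
  shows "natural_order PO_inf =
    natural_order (sym_inv_monoid PN2) \<inter> (carrier PO_inf \<times> carrier PO_inf)"
proof
  have eq: "(sym_inv_monoid PN2)\<lparr>carrier := carrier PO_inf\<rparr> = PO_inf"
    by (simp add: PO_inf_def)
  show "natural_order PO_inf \<subseteq>
      natural_order (sym_inv_monoid PN2) \<inter> (carrier PO_inf \<times> carrier PO_inf)"
    using natural_order_submonoid[OF monoid_sym_inv submonoid_PO_inf] unfolding eq .
  have monoid: "monoid PO_inf"
    using submonoid.submonoid_is_monoid[OF submonoid_PO_inf monoid_sym_inv] unfolding eq .
  have mult: "\<alpha> \<otimes>\<^bsub>PO_inf\<^esub> \<beta> = \<beta> \<circ>\<^sub>m \<alpha>" for \<alpha> \<beta>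
    by (simp add: PO_inf_def sym_inv_monoid_def)
  show "natural_order (sym_inv_monoid PN2) \<inter> (carrier PO_inf \<times> carrier PO_inf)
      \<subseteq> natural_order PO_inf"
  proof (rule subrelI)
    fix a b
    assume "(a, b) \<in> natural_order (sym_inv_monoid PN2) \<inter> (carrier PO_inf \<times> carrier PO_inf)"
    then have le: "a \<subseteq>\<^sub>m b" and a: "a \<in> carrier PO_inf" and b: "b \<in> carrier PO_inf"
      by (auto dest: natural_order_sym_inv_map_le)
    have inj: "inj_on a (dom a)" "inj_on b (dom b)"
      using a b by (auto simp: PO_inf_def sym_inv_monoid_def)
    have "dom a \<subseteq> PN2" "ran a \<subseteq> PN2" "finite (PN2 - dom a)" "finite (PN2 - ran a)"
      using a by (auto simp: PO_inf_def sym_inv_monoid_def)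
    then have x: "Some |` dom a \<in> carrier PO_inf" and y: "Some |` ran a \<in> carrier PO_inf"
      by (simp_all add: Some_restrict_in_PO_inf)
    have "a = b \<circ>\<^sub>m (Some |` dom a)" "a \<circ>\<^sub>m (Some |` dom a) = a"
      "a = (Some |` ran a) \<circ>\<^sub>m b" "(Some |` ran a) \<circ>\<^sub>m a = a"
      using map_comp_Some_dom map_comp_Some_ran le inj map_le_refl by metis+
    then show "(a, b) \<in> natural_order PO_inf"
      unfolding natural_order_monoid[OF monoid] mult using a b x y by blast
  qed
qed

end
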